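(* Let $n\geq1$. The vertices of the degree bi-enumerator polytope ${\cal B}_{2,n}=\mathrm{conv}\{b(G):G\subseteq K_{2,n}\}\subset\mathbb{R}^{n+1}\oplus\mathbb{R}^{3}$ are exactly the following: (1) $b_n(i,i,k)=2\cdot{\bf 1}_i\oplus(n-2i+k,\,2i-2k,\,k)$ for $i=0,\dots,n$ and $k\in\{\max\{0,2i-n\},\,i\}$; (2) $b_n(i,j,k)$ for $i=0,\dots,\lfloor\frac{n-1}{2}\rfloor$ and $j=\lceil\frac{n+1}{2}\rceil,\dots,n$, where $k=\max\{0,(i+j)-n\}$. Here $b_n(i,j,k):=({\bf 1}_i+{\bf 1}_j)\oplus(n-(i+j)+k,\ (i+j)-2k,\ k)$. The number of vertices is $(\frac n2)^2+2n$ for even $n$ and $(\frac{n+1}{2})^2+2n$ for odd $n$.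
   Context: $K_{2,n}=(U,V,E)$ is the complete bipartite graph with left vertices $U=\{u_1,u_2\}$, right vertices $V=\{v_1,\dots,v_n\}$, $E=U\times V$. A subgraph $G\subseteq K_{2,n}$ has the same vertex sets and edge set contained in $E$. Its degree bi-enumerator is $b(G)=a(G)\oplus c(G)\in\mathbb{R}^{n+1}\oplus\mathbb{R}^{3}$, where $a_k(G)$ ($k=0,\dots,n$) is the number of left vertices of degree $k$ and $c_k(G)$ ($k=0,1,2$) is the number of right vertices of degree $k$; vectors are indexed from $0$ and ${\bf 1}_k$ is the $k$-th unit vector of $\mathbb{R}^{n+1}$. (The vector $b_n(i,j,k)$ is the bi-enumerator of a subgraph in which $u_1,u_2$ have degrees $i\le j$ and exactly $k$ common neighbours.) *)

theory Defs
  imports "HOL-Analysis.Analysis"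
begin

text \<open>
  The degrees possible for a vertex with potential neighbours \<open>'a\<close>, i.e. the numbers
  \<open>0, \<dots>, CARD('a)\<close>. Thus \<open>real ^ 'a degree\<close> is the space of dimension \<open>CARD('a) + 1\<close>
  with coordinates indexed from 0.
\<close>

typedef 'a degree = "{0..CARD('a)}" morphisms nat_of_degree degree_of_nat
  by auto

lemma bij_betw_nat_of_degree: "bij_betw nat_of_degree (UNIV :: 'a degree set) {0..CARD('a)}"
  by (rule bij_betwI[where g = degree_of_nat])
    (use nat_of_degree in \<open>auto simp: nat_of_degree_inverse degree_of_nat_inverse\<close>)

instance degree :: (type) finite
  by standard (use bij_betw_finite[OF bij_betw_nat_of_degree] in simp)

lemma card_degree [simp]: "CARD('a degree) = CARD('a) + 1"
  using bij_betw_same_card[OF bij_betw_nat_of_degree] by simp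

definition unit_vec :: "nat \<Rightarrow> real ^ 'a degree"
  where "unit_vec k = (\<chi> l. if nat_of_degree l = k then 1 else 0)"

definition vec3 :: "real \<Rightarrow> real \<Rightarrow> real \<Rightarrow> real ^ 2 degree"
  where "vec3 x y z = (\<chi> l. [x, y, z] ! nat_of_degree l)"

text \<open>
  A subgraph of the complete bipartite graph with left vertices \<open>'u\<close> and right vertices \<open>'v\<close>
  is given by its edge set \<open>G \<subseteq> UNIV \<times> UNIV\<close>.
\<close>

definition left_degree :: "('u \<times> 'v) set \<Rightarrow> 'u \<Rightarrow> nat"
  where "left_degree G u = card {v. (u, v) \<in> G}"

definition right_degree :: "('u \<times> 'v) set \<Rightarrow> 'v \<Rightarrow> nat"
  where "right_degree G v = card {u. (u, v) \<in> G}"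

definition bi_enumerator ::
    "('u::finite \<times> 'v::finite) set \<Rightarrow> (real ^ 'v degree) \<times> (real ^ 'u degree)"
  where "bi_enumerator G =
    (\<chi> k. real (card {u. left_degree G u = nat_of_degree k}),
     \<chi> k. real (card {v. right_degree G v = nat_of_degree k}))"

definition bi_enumerator_polytope ::
    "((real ^ 'v::finite degree) \<times> (real ^ 'u::finite degree)) set"
  where "bi_enumerator_polytope =
    convex hull {bi_enumerator G | G :: ('u \<times> 'v) set. G \<subseteq> UNIV \<times> UNIV}"

definition vertices :: "'a::real_vector set \<Rightarrow> 'a set"
  where "vertices P = {x. x extreme_point_of P}"

definition b_vec :: "nat \<Rightarrow> nat \<Rightarrow> nat \<Rightarrow> nat \<Rightarrow> (real ^ 'v degree) \<times> (real ^ 2 degree)"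
  where "b_vec n i j k =
    (unit_vec i + unit_vec j,
     vec3 (real n - (real i + real j) + real k) ((real i + real j) - 2 * real k) (real k))"

end

theory Submission
  imports Defs
begin

text \<open>
  The generators are the points \<open>b\<^sub>n(i, j, k)\<close> with \<open>max 0 (i + j - n) \<le> k \<le> min i j\<close>, and
  \<open>b\<^sub>n(i, j, t)\<close> is affine in a real parameter \<open>t\<close>. On the diagonal \<open>i = j\<close> only the two ends of
  the range of \<open>k\<close> are extreme. For \<open>i < j\<close> the midpoints of \<open>b\<^sub>n(i, i, _)\<close> and \<open>b\<^sub>n(j, j, _)\<close>
  cover the range of \<open>k\<close> from above; from below they reach \<open>(f i + f j) / 2\<close> with
  \<open>f i = max 0 (2 i - n)\<close>. As \<open>f\<close> is affine on each side of \<open>n / 2\<close>, this value exceeds the least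
  \<open>k\<close> exactly if \<open>i < n / 2 < j\<close>, and only then does that \<open>k\<close> give a vertex.
\<close>

section \<open>Extreme points exposed by linear functionals\<close>

text \<open>The open half-space where \<open>f\<close> exceeds \<open>f x\<close> is convex, so it
  contains the hull of the other points but not \<open>x\<close>.\<close>

lemma extreme_point_of_convex_hull_exposed:
  fixes f :: "'a::euclidean_space \<Rightarrow> real"
  assumes "finite S" "x \<in> S" "linear f" "\<And>y. y \<in> S \<Longrightarrow> y \<noteq> x \<Longrightarrow> f x < f y"
  shows "x extreme_point_of (convex hull S)"
proof -
  have "convex (f -` {f x<..})"
    using assms(3) convex_linear_vimage convex_real_interval(3) by blast
  then have "convex hull (S - {x}) \<subseteq> f -` {f x<..}"
    using assms(4) by (intro hull_minimal) auto
  then have "x \<notin> convex hull (S - {x})"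
    by auto
  then show ?thesis
    using extreme_point_of_convex_hull_insert[of "S - {x}" x] assms(1,2)
    by (simp add: insert_absorb)
qed

section \<open>Algebra of the vectors \<open>b_vec\<close>\<close>

text \<open>The real parameter keeps the family closed under convex combinations with fixed left
  degrees, where \<open>k\<close> need not stay an integer.\<close>

definition b_real :: "nat \<Rightarrow> nat \<Rightarrow> nat \<Rightarrow> real \<Rightarrow> (real ^ 'v degree) \<times> (real ^ 2 degree)"
  where "b_real n i j t =
    (unit_vec i + unit_vec j,
     vec3 (real n - (real i + real j) + t) ((real i + real j) - 2 * t) t)"

lemma b_vec_eq_b_real: "b_vec n i j k = b_real n i j (real k)"
  by (simp add: b_vec_def b_real_def)

lemma b_vec_commute: "b_vec n i j k = b_vec n j i k"
  by (simp add: b_vec_def add.commute)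

lemma nat_of_degree_le: "nat_of_degree (l :: 'a degree) \<le> CARD('a)"
  using nat_of_degree[of l] by simp

lemma nat_of_degree_of_nat: "l \<le> CARD('a) \<Longrightarrow> nat_of_degree (degree_of_nat l :: 'a degree) = l"
  by (simp add: degree_of_nat_inverse)

lemma nat_of_2_degree_cases:
  fixes l :: "2 degree"
  obtains "nat_of_degree l = 0" | "nat_of_degree l = 1" | "nat_of_degree l = 2"
  using nat_of_degree_le[of l] by fastforce

lemma vec3_eqI:
  assumes "\<And>l. nat_of_degree l = 0 \<Longrightarrow> w $ l = x" "\<And>l. nat_of_degree l = 1 \<Longrightarrow> w $ l = y"
    "\<And>l. nat_of_degree l = 2 \<Longrightarrow> w $ l = z"
  shows "w = vec3 x y z"
  unfolding vec_eq_iff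
proof
  fix l :: "2 degree"
  show "w $ l = vec3 x y z $ l"
    by (cases l rule: nat_of_2_degree_cases) (auto simp: vec3_def assms)
qed

lemma vec3_nth_2: "vec3 x y z $ degree_of_nat 2 = z"
  by (simp add: vec3_def nat_of_degree_of_nat)

lemma unit_vec_nth:
  "l \<le> CARD('a) \<Longrightarrow> (unit_vec i :: real ^ 'a degree) $ degree_of_nat l = of_bool (l = i)"
  by (auto simp: unit_vec_def nat_of_degree_of_nat)

lemma b_vec_nth:
  "l \<le> CARD('v) \<Longrightarrow>
    fst (b_vec n i j k :: (real ^ 'v degree) \<times> _) $ degree_of_nat l = of_bool (l = i) + of_bool (l = j)"
  "snd (b_vec n i j k :: (real ^ 'v degree) \<times> _) $ degree_of_nat 2 = real k"
  by (simp_all add: b_vec_def unit_vec_nth vec3_nth_2)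

text \<open>The left block determines the unordered pair of degrees, the last coordinate determines
  \<open>k\<close>. The bounds matter: \<open>unit_vec i\<close> is zero once \<open>i\<close>
  exceeds \<open>CARD('v)\<close>.\<close>

lemma b_vec_eq_iff:
  assumes "i \<le> CARD('v)" "j \<le> CARD('v)" "i' \<le> CARD('v)" "j' \<le> CARD('v)"
  shows "(b_vec n i j k :: (real ^ 'v degree) \<times> _) = b_vec n i' j' k' \<longleftrightarrow>
    (i = i' \<and> j = j' \<or> i = j' \<and> j = i') \<and> k = k'"
proof
  assume eq: "(b_vec n i j k :: (real ^ 'v degree) \<times> _) = b_vec n i' j' k'"
  have "(of_bool (l = i) + of_bool (l = j) :: real) = of_bool (l = i') + of_bool (l = j')"
    if "l \<le> CARD('v)" for l
    using b_vec_nth(1)[OF that, of n i j k] b_vec_nth(1)[OF that, of n i' j' k'] eq by simp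
  from this[OF assms(1)] this[OF assms(2)] this[OF assms(3)]
  have "i = i' \<and> j = j' \<or> i = j' \<and> j = i'"
    by (auto simp: of_bool_def split: if_splits)
  moreover have "k = k'"
    using b_vec_nth(2)[of n i j k, where 'v = 'v] b_vec_nth(2)[of n i' j' k', where 'v = 'v] eq
    by simp
  ultimately show "(i = i' \<and> j = j' \<or> i = j' \<and> j = i') \<and> k = k'"
    by simp
qed (auto simp: b_vec_commute)

lemma vec3_add: "vec3 x y z + vec3 x' y' z' = vec3 (x + x') (y + y') (z + z')"
  by (rule vec3_eqI) (simp_all add: vec3_def)

lemma vec3_scaleR: "u *\<^sub>R vec3 x y z = vec3 (u * x) (u * y) (u * z)"
  by (rule vec3_eqI) (simp_all add: vec3_def)

lemma b_real_combination:
  "(1 - u) *\<^sub>R b_real n i j s + u *\<^sub>R b_real n i j t = b_real n i j ((1 - u) * s + u * t)"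
proof -
  have "(1 - u) *\<^sub>R v + u *\<^sub>R v = v" for v :: "real ^ 'a degree"
    by (simp flip: scaleR_left_distrib)
  then show ?thesis
    by (simp add: b_real_def vec3_add vec3_scaleR algebra_simps)
qed

lemma midpoint_b_real:
  "midpoint (b_real n i i s) (b_real n j j t) = b_real n i j ((s + t) / 2)"
  by (simp add: b_real_def midpoint_def vec3_add vec3_scaleR field_simps flip: scaleR_2)

lemma b_real_inject: "b_real n i j s = b_real n i j t \<longleftrightarrow> s = t"
  by (metis b_real_def prod.inject vec3_nth_2)

lemma b_real_in_open_segment:
  assumes "s < t" "t < r"
  shows "b_real n i j t \<in> open_segment (b_real n i j s) (b_real n i j r)"
proof -
  define u where "u = (t - s) / (r - s)"
  have u: "0 < u" "u < 1" "u * (r - s) = t - s"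
    using assms by (auto simp: u_def)
  from u(3) have "(1 - u) * s + u * r = t"
    by (simp add: algebra_simps)
  then have "(1 - u) *\<^sub>R b_real n i j s + u *\<^sub>R b_real n i j r = b_real n i j t"
    by (simp only: b_real_combination)
  moreover have "b_real n i j s \<noteq> b_real n i j r"
    using assms by (simp add: b_real_inject)
  ultimately show ?thesis
    unfolding in_segment using u(1,2) by metis
qed

section \<open>Bi-enumerators as an explicit finite set\<close>

text \<open>The inequalities describe two subsets of an \<open>n\<close>-set with sizes
  \<open>i\<close>, \<open>j\<close> and intersection size \<open>k\<close>; the last one bounds
  their union by inclusion-exclusion.\<close>

definition bi_enumerators :: "nat \<Rightarrow> ((real ^ 'v degree) \<times> (real ^ 2 degree)) set"
  where "bi_enumerators n =
    {b_vec n i j k | i j k. i \<le> n \<and> j \<le> n \<and> k \<le> i \<and> k \<le> j \<and> i + j \<le> n + k}"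

lemma b_vec_in_bi_enumerators:
  assumes "i \<le> n" "j \<le> n" "k \<le> i" "k \<le> j" "i + j \<le> n + k"
  shows "b_vec n i j k \<in> bi_enumerators n"
  unfolding bi_enumerators_def using assms by blast

lemma finite_bi_enumerators: "finite (bi_enumerators n)"
proof (rule finite_subset)
  show "bi_enumerators n \<subseteq> (\<lambda>(i, j, k). b_vec n i j k) ` ({..n} \<times> {..n} \<times> {..n})"
    by (force simp: bi_enumerators_def)
qed auto

text \<open>With \<open>A\<close> and \<open>B\<close> the neighbourhoods of the two left vertices,
  right vertices of degree 2, 1, 0 form the intersection, the symmetric difference and the
  complement of the union.\<close>

lemma bi_enumerator_eq_b_vec:
  fixes G :: "(2 \<times> 'v::finite) set"
  defines "A \<equiv> {v. (1, v) \<in> G}" and "B \<equiv> {v. (2, v) \<in> G}"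
  shows "bi_enumerator G = b_vec CARD('v) (card A) (card B) (card (A \<inter> B))"
proof -
  have left: "left_degree G 1 = card A" "left_degree G 2 = card B"
    by (simp_all add: left_degree_def A_def B_def)
  \<comment> \<open>If both left degrees equal \<open>d\<close>, both terms contribute and the count
    is 2.\<close>
  have "real (card {u. left_degree G u = d}) = of_bool (d = card A) + of_bool (d = card B)" for d
  proof -
    have "u \<in> {u. left_degree G u = d} \<longleftrightarrow>
        u \<in> (if d = card A then {1} else {}) \<union> (if d = card B then {2} else {})" for u
      using left exhaust_2[of u] by auto
    then have "{u. left_degree G u = d} =
        (if d = card A then {1} else {}) \<union> (if d = card B then {2} else {})"
      by blast
    then show ?thesis
      by auto
  qed
  then have fst: "(\<chi> l. real (card {u. left_degree G u = nat_of_degree l})) =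
      (unit_vec (card A) + unit_vec (card B) :: real ^ 'v degree)"
    by (auto simp: vec_eq_iff unit_vec_def)
  have right: "right_degree G v = of_bool (v \<in> A) + of_bool (v \<in> B)" for v
  proof -
    have "u \<in> {u. (u, v) \<in> G} \<longleftrightarrow>
        u \<in> (if v \<in> A then {1} else {}) \<union> (if v \<in> B then {2} else {})" for u
      using exhaust_2[of u] by (auto simp: A_def B_def)
    then have "{u. (u, v) \<in> G} = (if v \<in> A then {1} else {}) \<union> (if v \<in> B then {2} else {})"
      by blast
    then show ?thesis
      by (auto simp: right_degree_def)
  qed
  have deg2: "{v. right_degree G v = 2} = A \<inter> B"
    and deg1: "{v. right_degree G v = 1} = (A \<union> B) - (A \<inter> B)"
    and deg0: "{v. right_degree G v = 0} = - (A \<union> B)"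
    by (auto simp: right)
  have un: "real (card (A \<union> B)) = real (card A) + real (card B) - real (card (A \<inter> B))"
    using card_Un_Int[of A B] by simp
  have "card ((A \<union> B) - (A \<inter> B)) = card (A \<union> B) - card (A \<inter> B)"
    by (intro card_Diff_subset) auto
  moreover have "card (A \<inter> B) \<le> card (A \<union> B)"
    by (intro card_mono) auto
  ultimately have c1: "real (card ((A \<union> B) - (A \<inter> B))) =
      (real (card A) + real (card B)) - 2 * real (card (A \<inter> B))"
    using un by simp
  have "card (- (A \<union> B)) = CARD('v) - card (A \<union> B)"
    by (simp add: Compl_eq_Diff_UNIV card_Diff_subset)
  moreover have "card (A \<union> B) \<le> CARD('v)"
    by (intro card_mono) auto
  ultimately have c0: "real (card (- (A \<union> B))) =
      real CARD('v) - (real (card A) + real (card B)) + real (card (A \<inter> B))"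
    using un by simp
  have "(\<chi> l. real (card {v. right_degree G v = nat_of_degree l})) =
      vec3 (real CARD('v) - (real (card A) + real (card B)) + real (card (A \<inter> B)))
        ((real (card A) + real (card B)) - 2 * real (card (A \<inter> B))) (real (card (A \<inter> B)))"
    by (rule vec3_eqI) (simp_all only: vec_lambda_beta deg0 deg1 deg2 c0 c1)
  with fst show ?thesis
    by (simp add: bi_enumerator_def b_vec_def)
qed

lemma exists_sets_of_cards:
  assumes "k \<le> i" "k \<le> j" "i + j \<le> CARD('v::finite) + k"
  obtains A B :: "'v::finite set" where "card A = i" "card B = j" "card (A \<inter> B) = k"
proof -
  obtain e :: "nat \<Rightarrow> 'v" where e: "bij_betw e {0..<CARD('v)} UNIV"
    using ex_bij_betw_nat_finite[of "UNIV :: 'v set"] by auto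
  have card: "card (e ` X) = card X" if "X \<subseteq> {0..<CARD('v)}" for X
    using that e by (meson bij_betw_def card_image inj_on_subset)
  \<comment> \<open>The second interval starts \<open>k\<close> places before the end of the first,
    so they share exactly \<open>k\<close> numbers; \<open>e\<close> carries them to
    \<open>'v\<close>.\<close>
  let ?A = "{0..<i}" and ?B = "{i - k..<i - k + j}"
  have sub: "?A \<subseteq> {0..<CARD('v)}" "?B \<subseteq> {0..<CARD('v)}"
    using assms by auto
  have "e ` ?A \<inter> e ` ?B = e ` (?A \<inter> ?B)"
    using e sub by (metis bij_betw_def inj_on_image_Int)
  moreover have "?A \<inter> ?B = {i - k..<i}"
    using assms by auto
  moreover have "{i - k..<i} \<subseteq> {0..<CARD('v)}"
    using sub by auto
  ultimately show ?thesis
    using that[of "e ` ?A" "e ` ?B"] card sub assms by simp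
qed

lemma bi_enumerators_eq:
  "{bi_enumerator G | G :: (2 \<times> 'v::finite) set. G \<subseteq> UNIV \<times> UNIV} = bi_enumerators CARD('v)"
proof (intro equalityI subsetI)
  fix x assume "x \<in> {bi_enumerator G | G :: (2 \<times> 'v) set. G \<subseteq> UNIV \<times> UNIV}"
  then obtain G :: "(2 \<times> 'v) set" where G: "x = bi_enumerator G"
    by blast
  let ?A = "{v. (1, v) \<in> G}" and ?B = "{v. (2, v) \<in> G}"
  have "card (?A \<union> ?B) \<le> CARD('v)" "card ?A \<le> CARD('v)" "card ?B \<le> CARD('v)"
      "card (?A \<inter> ?B) \<le> card ?A" "card (?A \<inter> ?B) \<le> card ?B"
    by (intro card_mono; auto)+
  then show "x \<in> bi_enumerators CARD('v)"
    unfolding G bi_enumerator_eq_b_vec using card_Un_Int[of ?A ?B]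
    by (intro b_vec_in_bi_enumerators) auto
next
  fix x :: "(real ^ 'v degree) \<times> (real ^ 2 degree)"
  assume "x \<in> bi_enumerators CARD('v)"
  then obtain i j k where x: "x = b_vec CARD('v) i j k" "k \<le> i" "k \<le> j" "i + j \<le> CARD('v) + k"
    by (auto simp: bi_enumerators_def)
  obtain A B :: "'v set" where AB: "card A = i" "card B = j" "card (A \<inter> B) = k"
    using exists_sets_of_cards x(2-4) by blast
  have "bi_enumerator ({1 :: 2} \<times> A \<union> {2} \<times> B) = x"
    using AB by (simp add: bi_enumerator_eq_b_vec x(1))
  then show "x \<in> {bi_enumerator G | G :: (2 \<times> 'v) set. G \<subseteq> UNIV \<times> UNIV}"
    by blast
qed

lemma bi_enumerator_polytope_eq:
  "(bi_enumerator_polytope :: ((real ^ 'v::finite degree) \<times> (real ^ 2 degree)) set) =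
    convex hull bi_enumerators CARD('v)"
  unfolding bi_enumerator_polytope_def bi_enumerators_eq ..

section \<open>The listed points are vertices\<close>

text \<open>Truncated subtraction turns \<open>2 * i - n\<close> into the maximum with 0. Keeping
  triples apart from their vectors lets the vertices be counted on indices.\<close>

definition diagonal_indices :: "nat \<Rightarrow> (nat \<times> nat \<times> nat) set"
  where "diagonal_indices n = {(i, i, k) | i k. i \<le> n \<and> (k = 2 * i - n \<or> k = i)}"

definition split_indices :: "nat \<Rightarrow> (nat \<times> nat \<times> nat) set"
  where "split_indices n = {(i, j, i + j - n) | i j. 2 * i < n \<and> n < 2 * j \<and> j \<le> n}"

text \<open>
  In the exposing functionals below, the weight \<open>2 n + 1\<close> is large enough to force the left
  degrees of a minimiser; the remaining terms then select \<open>k\<close>.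
\<close>

lemma extreme_b_vec_diagonal:
  assumes i: "i \<le> CARD('v::finite)" and k: "k = 2 * i - CARD('v) \<or> k = i"
  shows "(b_vec CARD('v) i i k :: (real ^ 'v degree) \<times> _) extreme_point_of
    (convex hull bi_enumerators CARD('v))"
proof -
  define n where "n = CARD('v)"
  \<comment> \<open>The sign selects the end of the range of \<open>k\<close>: \<open>-1\<close>
    favours the largest value, \<open>1\<close> the least.\<close>
  define \<sigma> :: real where "\<sigma> = (if k = i then -1 else 1)"
  define f :: "(real ^ 'v degree) \<times> (real ^ 2 degree) \<Rightarrow> real" where
    "f p = - (2 * real n + 1) * (fst p $ degree_of_nat i) + \<sigma> * (snd p $ degree_of_nat 2)" for p
  have f: "f (b_vec n a b c) = - (2 * real n + 1) * (of_bool (i = a) + of_bool (i = b)) + \<sigma> * real c"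
    for a b c
    using i by (simp add: f_def b_vec_nth n_def)
  have "(b_vec n i i k :: (real ^ 'v degree) \<times> _) extreme_point_of (convex hull bi_enumerators n)"
  proof (rule extreme_point_of_convex_hull_exposed[where f = f])
    show "b_vec n i i k \<in> bi_enumerators n"
      using i k by (intro b_vec_in_bi_enumerators) (auto simp: n_def)
    show "linear f"
      unfolding f_def by (rule linearI) (simp_all add: algebra_simps)
    fix y :: "(real ^ 'v degree) \<times> (real ^ 2 degree)"
    assume "y \<in> bi_enumerators n" "y \<noteq> b_vec n i i k"
    then obtain a b c where y: "y = b_vec n a b c" "a \<le> n" "b \<le> n" "c \<le> a" "c \<le> b" "a + b \<le> n + c"
        and ne: "\<not> (a = i \<and> b = i \<and> c = k)"
      by (auto simp: bi_enumerators_def)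
    show "f (b_vec n i i k) < f y"
    proof (cases "a = i \<and> b = i")
      case True
      then have "\<sigma> * real k < \<sigma> * real c"
        using y ne k by (auto simp: \<sigma>_def n_def)
      with True show ?thesis
        by (simp add: f y(1))
    next
      case False
      \<comment> \<open>A wrong left degree costs at least \<open>2 * n + 1\<close>, while the terms
        in \<open>k\<close> and \<open>c\<close> differ by at most \<open>2 * n\<close>.\<close>
      have "\<bar>\<sigma> * real k\<bar> \<le> real n" "\<bar>\<sigma> * real c\<bar> \<le> real n"
        using y k i by (auto simp: \<sigma>_def n_def)
      then have "\<sigma> * real k < 2 * real n + 1 + \<sigma> * real c"
        by linarith
      with False show ?thesis
        by (auto simp: f y(1) algebra_simps of_bool_def)
    qed
  qed (rule finite_bi_enumerators)
  then show ?thesis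
    by (simp add: n_def)
qed

lemma extreme_b_vec_split:
  assumes ij: "2 * i < CARD('v::finite)" "CARD('v) < 2 * j" "j \<le> CARD('v)"
  shows "(b_vec CARD('v) i j (i + j - CARD('v)) :: (real ^ 'v degree) \<times> _) extreme_point_of
    (convex hull bi_enumerators CARD('v))"
proof -
  define n where "n = CARD('v)"
  define k where "k = i + j - n"
  \<comment> \<open>Any slope strictly between \<open>k\<close> and \<open>2 * j - n - k\<close> puts the minimum over the left degrees
    \<open>(i, i)\<close>, \<open>(i, j)\<close>, \<open>(j, j)\<close> at \<open>(i, j)\<close>; the midpoint does not depend on \<open>k\<close>.\<close>
  define \<beta> where "\<beta> = real j - real n / 2"
  define f :: "(real ^ 'v degree) \<times> (real ^ 2 degree) \<Rightarrow> real" where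
    "f p = - (2 * real n + 1) * (fst p $ degree_of_nat i + fst p $ degree_of_nat j)
      - \<beta> * (fst p $ degree_of_nat j) + snd p $ degree_of_nat 2" for p
  note ij = ij[folded n_def]
  have f: "f (b_vec n a b c) =
      - (2 * real n + 1) * (of_bool (i = a) + of_bool (i = b) + (of_bool (j = a) + of_bool (j = b)))
      - \<beta> * (of_bool (j = a) + of_bool (j = b)) + real c" for a b c
    using ij by (simp add: f_def b_vec_nth n_def)
  \<comment> \<open>The bound \<open>k < \<beta>\<close> uses both strict inequalities:
    \<open>\<beta>\<close> is positive, and it exceeds \<open>i + j - n\<close> by
    \<open>n / 2 - i\<close>.\<close>
  have \<beta>: "0 < \<beta>" "\<beta> \<le> real n" "real k < \<beta>" "real k \<le> real n"
    using ij by (auto simp: \<beta>_def k_def of_nat_diff_if field_simps)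
  have "(b_vec n i j k :: (real ^ 'v degree) \<times> _) extreme_point_of (convex hull bi_enumerators n)"
  proof (rule extreme_point_of_convex_hull_exposed[where f = f])
    show "b_vec n i j k \<in> bi_enumerators n"
      using ij by (intro b_vec_in_bi_enumerators) (auto simp: k_def)
    show "linear f"
      unfolding f_def by (rule linearI) (simp_all add: algebra_simps)
    fix y :: "(real ^ 'v degree) \<times> (real ^ 2 degree)"
    assume "y \<in> bi_enumerators n" "y \<noteq> b_vec n i j k"
    then obtain a b c where y: "y = b_vec n a b c" "a \<le> n" "b \<le> n" "c \<le> a" "c \<le> b" "a + b \<le> n + c"
        and ne: "\<not> (a = i \<and> b = j \<and> c = k)" "\<not> (a = j \<and> b = i \<and> c = k)"
      by (auto simp: bi_enumerators_def) (metis b_vec_commute)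
    consider "a = i" "b = i" | "a = j" "b = j" | "a = i \<and> b = j \<or> a = j \<and> b = i"
      | "a \<notin> {i, j} \<or> b \<notin> {i, j}"
      by blast
    then show "f (b_vec n i j k) < f y"
    proof cases
      case 1
      then show ?thesis
        using \<beta> ij by (simp add: f y(1))
    next
      case 2
      \<comment> \<open>Two \<open>j\<close>-subsets of an \<open>n\<close>-set share at least
        \<open>2 * j - n\<close> elements, which pays for the second \<open>\<beta>\<close>; then
        \<open>k < \<beta>\<close> decides.\<close>
      then have "2 * \<beta> \<le> real c"
        using y by (simp add: \<beta>_def)
      with 2 show ?thesis
        using \<beta> ij by (simp add: f y(1))
    next
      case 3
      then have "k < c"
        using y ne by (auto simp: k_def)
      with 3 show ?thesis
        using ij by (auto simp: f y(1))
    next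
      case 4
      \<comment> \<open>As \<open>i\<close> and \<open>j\<close> differ, at most one of
        \<open>a\<close>, \<open>b\<close> can now earn the weight \<open>M\<close>. The lost
        \<open>M\<close> outweighs \<open>k\<close>, which is at most \<open>n\<close>.\<close>
      define M where "M = 2 * real n + 1"
      define X :: real where "X = of_bool (i = a) + of_bool (i = b) + (of_bool (j = a) + of_bool (j = b))"
      define Y :: real where "Y = of_bool (j = a) + of_bool (j = b)"
      have "X \<le> 1" "Y \<le> 1"
        using 4 ij by (auto simp: of_bool_def X_def Y_def)
      then have "M * X \<le> M * 1" "\<beta> * Y \<le> \<beta> * 1"
        using \<beta> by (intro mult_left_mono; simp add: M_def)+
      moreover have "f y = - (M * X) - \<beta> * Y + real c"
        unfolding f y(1) M_def X_def Y_def by (simp only: mult_minus_left)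
      ultimately have "- M - \<beta> \<le> f y"
        by simp
      moreover have "f (b_vec n i j k) = - 2 * M - \<beta> + real k"
        using ij by (simp add: f M_def)
      ultimately show ?thesis
        using \<beta> by (simp add: M_def)
    qed
  qed (rule finite_bi_enumerators)
  then show ?thesis
    by (simp add: n_def k_def)
qed

section \<open>No other bi-enumerator is a vertex\<close>

lemma extreme_imp_in_indices:
  fixes n i j k :: nat
  assumes n: "n = CARD('v::finite)"
    and bounds: "i \<le> j" "j \<le> n" "k \<le> i" "i + j \<le> n + k"
    and extreme: "(b_vec n i j k :: (real ^ 'v degree) \<times> _) extreme_point_of
      (convex hull bi_enumerators n)"
  shows "(i, j, k) \<in> diagonal_indices n \<union> split_indices n"
proof (rule ccontr)
  let ?C = "convex hull bi_enumerators n :: ((real ^ 'v degree) \<times> _) set"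
  assume not_in: "(i, j, k) \<notin> diagonal_indices n \<union> split_indices n"
  have not_between: False if "b_vec n i j k \<in> open_segment p q" "p \<in> ?C" "q \<in> ?C" for p q
    using extreme that by (auto simp: extreme_point_of_def)
  have top: "b_real n a a (real a) \<in> ?C" if "a \<le> n" for a
    unfolding b_vec_eq_b_real[symmetric] using that
    by (intro hull_inc b_vec_in_bi_enumerators) auto
  have bottom: "b_real n a a (real (2 * a - n)) \<in> ?C" if "a \<le> n" for a
    unfolding b_vec_eq_b_real[symmetric] using that
    by (intro hull_inc b_vec_in_bi_enumerators) auto
  show False
  proof (cases "i = j")
    case True
    with not_in bounds have "2 * i - n < k" "k < i"
      by (force simp: diagonal_indices_def)+
    then have "b_real n i i (real k) \<in> open_segment (b_real n i i (real (2 * i - n))) (b_real n i i (real i))"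
      by (intro b_real_in_open_segment) simp_all
    with True show False
      using not_between top bottom bounds by (metis b_vec_eq_b_real)
  next
    case False
    have mid_in: "b_real n i j ((s + t) / 2) \<in> ?C" if "b_real n i i s \<in> ?C" "b_real n j j t \<in> ?C" for s t
      using closed_segment_subset[OF that convex_convex_hull] midpoint_in_closed_segment
      unfolding midpoint_b_real[symmetric] by blast
    have upper: "b_real n i j ((real i + real j) / 2) \<in> ?C"
      using mid_in top bounds by auto
    \<comment> \<open>Since \<open>k \<le> i < j\<close>, the point \<open>upper\<close> lies
      strictly above \<open>k\<close> on the line of \<open>b_real n i j\<close>. Any hull point
      strictly below \<open>k\<close> on that line therefore gives a contradiction.\<close>
    have above: False if "b_real n i j s \<in> ?C" "s < real k" for s
    proof -
      have "real k < (real i + real j) / 2"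
        using bounds False by simp
      then show False
        using not_between[OF _ that(1) upper] b_real_in_open_segment[OF that(2)]
        unfolding b_vec_eq_b_real by blast
    qed
    show False
    proof (cases "2 * i < n \<and> n < 2 * j")
      case True
      then have "i + j - n < k"
        using not_in bounds by (force simp: split_indices_def)
      moreover have "b_real n i j (real (i + j - n)) \<in> ?C"
        unfolding b_vec_eq_b_real[symmetric] using bounds True
        by (intro hull_inc b_vec_in_bi_enumerators) auto
      ultimately show False
        using above of_nat_less_iff by blast
    next
      case not_split: False
      let ?s = "real (2 * i - n)" and ?t = "real (2 * j - n)"
      have in_C: "b_real n i i ?s \<in> ?C" "b_real n j j ?t \<in> ?C"
        using bottom bounds by auto
      \<comment> \<open>Here \<open>i\<close> and \<open>j\<close> lie weakly on the same side of
        \<open>n / 2\<close>, so the average of the two lower ends is the maximum of 0 and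
        \<open>i + j - n\<close>.\<close>
      have "(?s + ?t) / 2 \<le> real k"
        using not_split bounds by (auto simp: of_nat_diff_if)
      \<comment> \<open>At equality there is no room below \<open>k\<close>, but the point is then
        itself the midpoint of two distinct hull points.\<close>
      moreover have "(?s + ?t) / 2 \<noteq> real k"
      proof
        assume "(?s + ?t) / 2 = real k"
        then have "b_vec n i j k = midpoint (b_real n i i ?s) (b_real n j j ?t)"
          by (simp add: midpoint_b_real b_vec_eq_b_real)
        moreover have "(b_real n i i ?s :: (real ^ 'v degree) \<times> _) \<noteq> b_real n j j ?t"
          unfolding b_vec_eq_b_real[symmetric] using False bounds n by (simp add: b_vec_eq_iff)
        ultimately show False
          using not_between in_C by (metis midpoint_in_open_segment)
      qed
      ultimately show False
        using above mid_in in_C by fastforce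
    qed
  qed
qed

section \<open>The vertex set and its size\<close>

text \<open>Requiring \<open>i \<le> j\<close> removes the symmetry in the left degrees, so counting
  vertices reduces to counting triples.\<close>

lemma inj_on_b_vec:
  "inj_on (\<lambda>(i, j, k). b_vec n i j k :: (real ^ 'v degree) \<times> _)
    {(i, j, k). i \<le> j \<and> j \<le> CARD('v)}"
  by (auto simp: inj_on_def b_vec_eq_iff)

lemma vertices_bi_enumerator_polytope:
  "vertices (bi_enumerator_polytope :: ((real ^ 'v::finite degree) \<times> (real ^ 2 degree)) set) =
    (\<lambda>(i, j, k). b_vec CARD('v) i j k) ` (diagonal_indices CARD('v) \<union> split_indices CARD('v))"
  (is "?V = ?f ` ?I")
proof (intro equalityI subsetI)
  fix x :: "(real ^ 'v degree) \<times> (real ^ 2 degree)"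
  assume "x \<in> ?V"
  then have x: "x extreme_point_of (convex hull bi_enumerators CARD('v))"
    by (simp add: vertices_def bi_enumerator_polytope_eq)
  then obtain i j k where ijk: "x = b_vec CARD('v) i j k" "i \<le> CARD('v)" "j \<le> CARD('v)"
      "k \<le> i" "k \<le> j" "i + j \<le> CARD('v) + k"
    using extreme_point_of_convex_hull by (fastforce simp: bi_enumerators_def)
  obtain i' j' where "i' \<le> j'" "j' \<le> CARD('v)" "k \<le> i'" "i' + j' \<le> CARD('v) + k"
      and x': "x = b_vec CARD('v) i' j' k"
    using ijk b_vec_commute by (metis add.commute linear)
  then have "(i', j', k) \<in> ?I"
    using extreme_imp_in_indices[OF refl] x by blast
  then show "x \<in> ?f ` ?I"
    unfolding x' by force
next
  fix x :: "(real ^ 'v degree) \<times> (real ^ 2 degree)"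
  assume "x \<in> ?f ` ?I"
  then show "x \<in> ?V"
    by (auto simp: vertices_def bi_enumerator_polytope_eq diagonal_indices_def
        split_indices_def intro!: extreme_b_vec_diagonal extreme_b_vec_split)
qed

text \<open>The two choices of \<open>k\<close> coincide exactly for \<open>i = 0\<close> and
  \<open>i = n\<close>, which leaves \<open>(n + 1) + (n - 1)\<close> triples.\<close>

lemma card_diagonal_indices:
  assumes "n \<ge> 1"
  shows "card (diagonal_indices n) = 2 * n"
proof -
  have "diagonal_indices n =
      (\<lambda>i. (i, i, i)) ` {..n} \<union> (\<lambda>i. (i, i, 2 * i - n)) ` {1..<n}"
    by (auto simp: diagonal_indices_def image_iff)
  moreover have "card ((\<lambda>i. (i, i, i)) ` {..n} \<union> (\<lambda>i. (i, i, 2 * i - n)) ` {1..<n}) =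
      card {..n} + card {1..<n}"
    by (subst card_Un_disjoint) (auto simp: card_image inj_on_def)
  ultimately show ?thesis
    using assms by simp
qed

lemma split_indices_eq:
  "split_indices n = (\<lambda>(i, j). (i, j, i + j - n)) ` ({..<(n + 1) div 2} \<times> {n div 2<..n})"
proof -
  have "2 * i < n \<longleftrightarrow> i < (n + 1) div 2" "n < 2 * i \<longleftrightarrow> n div 2 < i" for i
    by linarith+
  then show ?thesis
    by (auto simp: split_indices_def)
qed

text \<open>The degrees below \<open>n / 2\<close> and those above it are equally many, as
  \<open>i \<mapsto> n - i\<close> exchanges them.\<close>

lemma card_split_indices: "card (split_indices n) = ((n + 1) div 2)\<^sup>2"
proof -
  have "n - n div 2 = (n + 1) div 2"
    by linarith
  then show ?thesis
    unfolding split_indices_eq by (subst card_image) (auto simp: inj_on_def power2_eq_square)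
qed

lemma card_vertices_bi_enumerator_polytope:
  "card (vertices (bi_enumerator_polytope :: ((real ^ 'v::finite degree) \<times> (real ^ 2 degree)) set)) =
    ((CARD('v) + 1) div 2)\<^sup>2 + 2 * CARD('v)"
proof -
  let ?n = "CARD('v)"
  have "card (vertices (bi_enumerator_polytope :: ((real ^ 'v degree) \<times> (real ^ 2 degree)) set)) =
      card (diagonal_indices ?n \<union> split_indices ?n)"
    unfolding vertices_bi_enumerator_polytope
    by (intro card_image inj_on_subset[OF inj_on_b_vec])
      (auto simp: diagonal_indices_def split_indices_def)
  also have "\<dots> = card (diagonal_indices ?n) + card (split_indices ?n)"
  proof (rule card_Un_disjoint)
    show "finite (diagonal_indices ?n)"
      using card_diagonal_indices[of ?n] by (intro card_ge_0_finite) simp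
  qed (auto simp: split_indices_eq diagonal_indices_def)
  finally show ?thesis
    by (simp add: card_diagonal_indices card_split_indices)
qed

theorem theorem3p3:
  fixes n :: nat
  assumes "n \<ge> 1"
    and "CARD('v::finite) = n"
  shows
    "vertices (bi_enumerator_polytope :: ((real ^ 'v degree) \<times> (real ^ 2 degree)) set) =
       {b_vec n i i k | i k. i \<le> n \<and> int k \<in> {max 0 (2 * int i - int n), int i}} \<union>
       {b_vec n i j k | i j k. int i \<le> \<lfloor>(real n - 1) / 2\<rfloor> \<and>
          \<lceil>(real n + 1) / 2\<rceil> \<le> int j \<and> j \<le> n \<and> int k = max 0 ((int i + int j) - int n)}
     \<and> (\<forall>i k. i \<le> n \<and> int k \<in> {max 0 (2 * int i - int n), int i} \<longrightarrow>
          (b_vec n i i k :: (real ^ 'v degree) \<times> (real ^ 2 degree)) =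
            (2 *\<^sub>R unit_vec i,
             vec3 (real n - 2 * real i + real k) (2 * real i - 2 * real k) (real k)))
     \<and> (even n \<longrightarrow>
          real (card (vertices (bi_enumerator_polytope ::
            ((real ^ 'v degree) \<times> (real ^ 2 degree)) set))) = (real n / 2)\<^sup>2 + 2 * real n)
     \<and> (odd n \<longrightarrow>
          real (card (vertices (bi_enumerator_polytope ::
            ((real ^ 'v degree) \<times> (real ^ 2 degree)) set))) = ((real n + 1) / 2)\<^sup>2 + 2 * real n)"
proof (intro conjI allI impI)
  let ?V = "vertices (bi_enumerator_polytope :: ((real ^ 'v degree) \<times> (real ^ 2 degree)) set)"
  let ?D = "{b_vec n i i k :: (real ^ 'v degree) \<times> (real ^ 2 degree) | i k.
    i \<le> n \<and> int k \<in> {max 0 (2 * int i - int n), int i}}"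
  let ?S = "{b_vec n i j k :: (real ^ 'v degree) \<times> (real ^ 2 degree) | i j k.
    int i \<le> \<lfloor>(real n - 1) / 2\<rfloor> \<and> \<lceil>(real n + 1) / 2\<rceil> \<le> int j \<and> j \<le> n \<and>
    int k = max 0 ((int i + int j) - int n)}"
  have "int k \<in> {max 0 (2 * int i - int n), int i} \<longleftrightarrow> k = 2 * i - n \<or> k = i" for i k
    by auto
  then have D: "?D = (\<lambda>(i, j, k). b_vec n i j k) ` diagonal_indices n"
    by (force simp: diagonal_indices_def)
  \<comment> \<open>For integers, the shifts by 1 in the floor and the ceiling express strict
    comparison with \<open>n / 2\<close>, for either parity of \<open>n\<close>.\<close>
  have "int i \<le> \<lfloor>(real n - 1) / 2\<rfloor> \<longleftrightarrow> 2 * i < n"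
      "\<lceil>(real n + 1) / 2\<rceil> \<le> int i \<longleftrightarrow> n < 2 * i" for i
    by (simp_all add: le_floor_iff ceiling_le_iff field_simps) linarith+
  moreover have "int k = max 0 ((int i + int j) - int n) \<longleftrightarrow> k = i + j - n" for i j k
    by auto
  ultimately have "?S = {b_vec n i j k | i j k. 2 * i < n \<and> n < 2 * j \<and> j \<le> n \<and> k = i + j - n}"
    by simp
  also have "\<dots> = (\<lambda>(i, j, k). b_vec n i j k) ` split_indices n"
    by (force simp: split_indices_def)
  finally show "?V = ?D \<union> ?S"
    unfolding vertices_bi_enumerator_polytope assms(2) D image_Un by simp
  show "(b_vec n i i k :: (real ^ 'v degree) \<times> (real ^ 2 degree)) =
      (2 *\<^sub>R unit_vec i, vec3 (real n - 2 * real i + real k) (2 * real i - 2 * real k) (real k))" for i k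
    by (simp add: b_vec_def scaleR_2)
  show "real (card ?V) = (real n / 2)\<^sup>2 + 2 * real n" if "even n"
    using that by (auto simp: card_vertices_bi_enumerator_polytope assms(2) elim!: evenE)
  show "real (card ?V) = ((real n + 1) / 2)\<^sup>2 + 2 * real n" if "odd n"
    using that by (auto simp: card_vertices_bi_enumerator_polytope assms(2) elim!: oddE)
qed

end
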